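(* Let $\lambda$ be a complex parameter, fix a value of $\sqrt{\lambda^2+\lambda}$, and for a smooth positive function $z(x,y)$ put $$A(\lambda)=\begin{pmatrix}\frac12\sqrt{\lambda^2+\lambda}\,z_y+\frac{1+2\lambda}{4}\frac{z_x}{z} & (\lambda+1)\sqrt z\\ \lambda\sqrt z & -\frac12\sqrt{\lambda^2+\lambda}\,z_y-\frac{1+2\lambda}{4}\frac{z_x}{z}\end{pmatrix},$$ $$B(\lambda)=\begin{pmatrix}\frac12\sqrt{\lambda^2+\lambda}\,\frac{z_x}{z^2}+\frac{1+2\lambda}{4}\frac{z_y}{z} & \frac{\sqrt{\lambda^2+\lambda}}{\sqrt z}\\ \frac{\sqrt{\lambda^2+\lambda}}{\sqrt z} & -\frac12\sqrt{\lambda^2+\lambda}\,\frac{z_x}{z^2}-\frac{1+2\lambda}{4}\frac{z_y}{z}\end{pmatrix}.$$ Then the pair $A(\lambda),B(\lambda)$ is an $\mathfrak{sl}(2)$-valued zero curvature representation, depending on the parameter $\lambda$, of the equation $$z_{yy}+\left(\frac1z\right)_{xx}+2=0;$$ that is, for every $\lambda$ and every positive solution $z$ of this equation, $$\partial_yA(\lambda)-\partial_xB(\lambda)+[A(\lambda),B(\lambda)]=0.$$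
   Context: The equation $z_{yy}+(1/z)_{xx}+2=0$ for an unknown function $z(x,y)$ is called the constant astigmatism equation. A pair of $\mathfrak{sl}(2)$-valued (traceless $2\times2$) matrix functions $A,B$ depending on $z$ and its derivatives is a zero curvature representation of the equation if $A_y-B_x+[A,B]=0$ holds as a consequence of the equation, where $[A,B]=AB-BA$ and subscripts denote (total) derivatives with respect to $x$, $y$. All considerations are local and functions are smooth. *)

theory Defs
  imports "HOL-Analysis.Analysis"
begin

definition partial_x :: "(real \<times> real \<Rightarrow> 'a::real_normed_vector) \<Rightarrow> real \<times> real \<Rightarrow> 'a" where
  "partial_x f p = vector_derivative (\<lambda>t. f (t, snd p)) (at (fst p))"

definition partial_y :: "(real \<times> real \<Rightarrow> 'a::real_normed_vector) \<Rightarrow> real \<times> real \<Rightarrow> 'a" where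
  "partial_y f p = vector_derivative (\<lambda>t. f (fst p, t)) (at (snd p))"

(* Only used for open U, where differentiability of f makes both partial derivatives genuine. *)
primrec Ck_on :: "nat \<Rightarrow> (real \<times> real) set \<Rightarrow> (real \<times> real \<Rightarrow> 'a::real_normed_vector) \<Rightarrow> bool" where
  "Ck_on 0 U f \<longleftrightarrow> continuous_on U f"
| "Ck_on (Suc k) U f \<longleftrightarrow>
     f differentiable_on U \<and> Ck_on k U (partial_x f) \<and> Ck_on k U (partial_y f)"

definition smooth_on :: "(real \<times> real) set \<Rightarrow> (real \<times> real \<Rightarrow> 'a::real_normed_vector) \<Rightarrow> bool" where
  "smooth_on U f \<longleftrightarrow> (\<forall>k. Ck_on k U f)"

(* Local functions are total functions of which only the values on the open set U matter. *)
definition positive_smooth :: "(real \<times> real) set \<Rightarrow> (real \<times> real \<Rightarrow> real) \<Rightarrow> bool" where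
  "positive_smooth U z \<longleftrightarrow> open U \<and> smooth_on U z \<and> (\<forall>p\<in>U. z p > 0)"

definition constant_astigmatism_solution ::
    "(real \<times> real) set \<Rightarrow> (real \<times> real \<Rightarrow> real) \<Rightarrow> bool" where
  "constant_astigmatism_solution U z \<longleftrightarrow> positive_smooth U z \<and>
     (\<forall>p\<in>U. partial_y (partial_y z) p + partial_x (partial_x (\<lambda>q. 1 / z q)) p + 2 = 0)"

type_synonym matrix_operator =
  "(real \<times> real \<Rightarrow> real) \<Rightarrow> real \<times> real \<Rightarrow> complex^2^2"

definition sl2 :: "(complex^2^2) set" where
  "sl2 = {M. trace M = 0}"

definition jet_agree ::
    "nat \<Rightarrow> (real \<times> real \<Rightarrow> real) \<Rightarrow> real \<times> real \<Rightarrow> (real \<times> real \<Rightarrow> real) \<Rightarrow> real \<times> real \<Rightarrow> bool" where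
  "jet_agree k z p w q \<longleftrightarrow> (\<forall>i j. i + j \<le> k \<longrightarrow>
     (partial_x ^^ i) ((partial_y ^^ j) z) p = (partial_x ^^ i) ((partial_y ^^ j) w) q)"

(* M is a smooth matrix function of z and finitely many of its derivatives, without explicit
   dependence on x and y. *)
definition differential_function :: "matrix_operator \<Rightarrow> bool" where
  "differential_function M \<longleftrightarrow>
     (\<forall>U z. positive_smooth U z \<longrightarrow> smooth_on U (M z)) \<and>
     (\<exists>k. \<forall>U z p V w q. positive_smooth U z \<and> p \<in> U \<and> positive_smooth V w \<and> q \<in> V \<and>
        jet_agree k z p w q \<longrightarrow> M z p = M w q)"

definition commutator :: "complex^2^2 \<Rightarrow> complex^2^2 \<Rightarrow> complex^2^2" where
  "commutator M N = M ** N - N ** M"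

(* Along a solution, total derivatives become derivatives of the matrix functions of (x, y). *)
definition zero_curvature_representation :: "matrix_operator \<Rightarrow> matrix_operator \<Rightarrow> bool" where
  "zero_curvature_representation A B \<longleftrightarrow>
     differential_function A \<and> differential_function B \<and>
     (\<forall>U z. positive_smooth U z \<longrightarrow> (\<forall>p\<in>U. A z p \<in> sl2 \<and> B z p \<in> sl2)) \<and>
     (\<forall>U z. constant_astigmatism_solution U z \<longrightarrow>
        (\<forall>p\<in>U. partial_y (A z) p - partial_x (B z) p + commutator (A z p) (B z p) = 0))"

(* The argument s stands for the chosen value of the square root of l^2 + l. *)
definition A_mat :: "complex \<Rightarrow> complex \<Rightarrow> matrix_operator" where
  "A_mat l s z p =
     (let d = 1/2 * s * of_real (partial_y z p)
              + (1 + 2 * l) / 4 * of_real (partial_x z p / z p)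
      in vector [vector [d, (l + 1) * of_real (sqrt (z p))],
                 vector [l * of_real (sqrt (z p)), - d]])"

definition B_mat :: "complex \<Rightarrow> complex \<Rightarrow> matrix_operator" where
  "B_mat l s z p =
     (let d = 1/2 * s * of_real (partial_x z p / (z p)\<^sup>2)
              + (1 + 2 * l) / 4 * of_real (partial_y z p / z p)
      in vector [vector [d, s / of_real (sqrt (z p))],
                 vector [s / of_real (sqrt (z p)), - d]])"

end

theory Submission
  imports Defs
begin

text \<open>
  Write \<open>A\<close> and \<open>B\<close> as combinations of constant matrices whose coefficients are real functions of
  \<open>z\<close>, \<open>z\<^sub>x\<close>, \<open>z\<^sub>y\<close>. In \<open>A\<^sub>y - B\<^sub>x\<close> the term with coefficient \<open>(1 + 2\<lambda>) / 4\<close> vanishes, because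
  \<open>(z\<^sub>x / z)\<^sub>y = (z\<^sub>y / z)\<^sub>x\<close> by the symmetry of second derivatives, and the diagonal term with
  coefficient \<open>s / 2\<close> is \<open>z\<^sub>y\<^sub>y + (1/z)\<^sub>x\<^sub>x = - 2\<close>. What remains is cancelled by the commutator, using
  \<open>s\<^sup>2 = \<lambda>\<^sup>2 + \<lambda>\<close> in the off-diagonal entries.
\<close>

section \<open>Calculus of partial derivatives\<close>

text \<open>\<open>vector_derivative\<close> is defined by choice and is informative only once the
  slice is known to be differentiable. Composing \<open>f\<close> with the affine embedding of a
  horizontal line supplies this; the vertical case is analogous.\<close>

lemma has_vector_derivative_partial_x:
  assumes "f differentiable at p"
  shows "((\<lambda>t. f (t, snd p)) has_vector_derivative partial_x f p) (at (fst p))"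
proof -
  have "(\<lambda>t. (t, snd p)) differentiable at (fst p)"
    by (auto intro!: derivative_eq_intros simp: differentiable_def)
  then have "(f \<circ> (\<lambda>t. (t, snd p))) differentiable at (fst p)"
    using assms by (intro differentiable_chain_at) auto
  then show ?thesis
    by (simp add: partial_x_def vector_derivative_works o_def)
qed

lemma has_vector_derivative_partial_y:
  assumes "f differentiable at p"
  shows "((\<lambda>t. f (fst p, t)) has_vector_derivative partial_y f p) (at (snd p))"
proof -
  have "(\<lambda>t. (fst p, t)) differentiable at (snd p)"
    by (auto intro!: derivative_eq_intros simp: differentiable_def)
  then have "(f \<circ> (\<lambda>t. (fst p, t))) differentiable at (snd p)"
    using assms by (intro differentiable_chain_at) auto
  then show ?thesis
    by (simp add: partial_y_def vector_derivative_works o_def)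
qed

lemma partial_x_eqI:
  "((\<lambda>t. f (t, snd p)) has_vector_derivative D) (at (fst p)) \<Longrightarrow> partial_x f p = D"
  by (simp add: partial_x_def vector_derivative_at)

lemma partial_y_eqI:
  "((\<lambda>t. f (fst p, t)) has_vector_derivative D) (at (snd p)) \<Longrightarrow> partial_y f p = D"
  by (simp add: partial_y_def vector_derivative_at)

text \<open>Points of a slice close to \<open>p\<close> stay in the open set \<open>U\<close>.
  Formulas valid only on \<open>U\<close>, such as those that need \<open>z q > 0\<close>, can
  therefore be differentiated.\<close>

lemma partial_cong:
  assumes "open U" "p \<in> U" "\<And>q. q \<in> U \<Longrightarrow> f q = g q"
  shows partial_x_cong: "partial_x f p = partial_x g p"
    and partial_y_cong: "partial_y f p = partial_y g p"
proof -
  have "((\<lambda>t. (t, snd p)) \<longlongrightarrow> (fst p, snd p)) (nhds (fst p))"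
    "((\<lambda>t. (fst p, t)) \<longlongrightarrow> (fst p, snd p)) (nhds (snd p))"
    by (intro tendsto_intros filterlim_ident)+
  then have *: "\<forall>\<^sub>F t in nhds (fst p). (t, snd p) \<in> U" "\<forall>\<^sub>F t in nhds (snd p). (fst p, t) \<in> U"
    using assms(1,2) by (auto dest: topological_tendstoD)
  show "partial_x f p = partial_x g p" "partial_y f p = partial_y g p"
    unfolding partial_x_def partial_y_def
    by (intro vector_derivative_cong_eq eventually_mono[OF *(1)] eventually_mono[OF *(2)];
        simp add: assms(3))+
qed

lemma partial_add:
  assumes "f differentiable at p" "g differentiable at p"
  shows partial_x_add: "partial_x (\<lambda>q. f q + g q) p = partial_x f p + partial_x g p"
    and partial_y_add: "partial_y (\<lambda>q. f q + g q) p = partial_y f p + partial_y g p"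
  using assms
  by (auto intro!: partial_x_eqI partial_y_eqI has_vector_derivative_add
      has_vector_derivative_partial_x has_vector_derivative_partial_y)

lemma partial_scaleR_const:
  fixes f :: "real \<times> real \<Rightarrow> real"
  assumes "f differentiable at p"
  shows partial_x_scaleR_const: "partial_x (\<lambda>q. f q *\<^sub>R c) p = partial_x f p *\<^sub>R c"
    and partial_y_scaleR_const: "partial_y (\<lambda>q. f q *\<^sub>R c) p = partial_y f p *\<^sub>R c"
  using assms
  by (auto intro!: partial_x_eqI partial_y_eqI
      bounded_linear.has_vector_derivative[OF bounded_linear_scaleR_left]
      has_vector_derivative_partial_x has_vector_derivative_partial_y)

text \<open>This is the shape given to both matrices in \<open>A_mat_eq\<close> and
  \<open>B_mat_eq\<close>: three constant matrices with real coefficient functions. Only real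
  functions are left to differentiate.\<close>

lemma partial_sum3:
  fixes f g h :: "real \<times> real \<Rightarrow> real"
  assumes "f differentiable at p" "g differentiable at p" "h differentiable at p"
  shows partial_x_sum3: "partial_x (\<lambda>q. f q *\<^sub>R a + g q *\<^sub>R b + h q *\<^sub>R c) p
      = partial_x f p *\<^sub>R a + partial_x g p *\<^sub>R b + partial_x h p *\<^sub>R c"
    and partial_y_sum3: "partial_y (\<lambda>q. f q *\<^sub>R a + g q *\<^sub>R b + h q *\<^sub>R c) p
      = partial_y f p *\<^sub>R a + partial_y g p *\<^sub>R b + partial_y h p *\<^sub>R c"
  using assms by (simp_all add: partial_add partial_scaleR_const)

lemma partial_mult:
  fixes f g :: "real \<times> real \<Rightarrow> real"
  assumes "f differentiable at p" "g differentiable at p"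
  shows partial_x_mult: "partial_x (\<lambda>q. f q * g q) p = f p * partial_x g p + partial_x f p * g p"
    and partial_y_mult: "partial_y (\<lambda>q. f q * g q) p = f p * partial_y g p + partial_y f p * g p"
  using has_vector_derivative_mult[OF has_vector_derivative_partial_x[OF assms(1)]
      has_vector_derivative_partial_x[OF assms(2)]]
    has_vector_derivative_mult[OF has_vector_derivative_partial_y[OF assms(1)]
      has_vector_derivative_partial_y[OF assms(2)]]
  by (auto intro!: partial_x_eqI partial_y_eqI)

text \<open>Reciprocals and square roots of \<open>z\<close> are all written as real powers, so this
  one chain rule replaces separate rules for quotients and roots.\<close>

lemma partial_powr:
  fixes f :: "real \<times> real \<Rightarrow> real"
  assumes "f differentiable at p" "f p > 0"
  shows partial_x_powr: "partial_x (\<lambda>q. f q powr a) p = a * f p powr (a - 1) * partial_x f p"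
    and partial_y_powr: "partial_y (\<lambda>q. f q powr a) p = a * f p powr (a - 1) * partial_y f p"
proof -
  note deriv = has_real_derivative_powr[OF assms(2), of a]
  have "((\<lambda>t. f (t, snd p)) has_real_derivative partial_x f p) (at (fst p))"
    "((\<lambda>t. f (fst p, t)) has_real_derivative partial_y f p) (at (snd p))"
    using has_vector_derivative_partial_x[OF assms(1)] has_vector_derivative_partial_y[OF assms(1)]
    by (simp_all add: has_real_derivative_iff_has_vector_derivative)
  then show "partial_x (\<lambda>q. f q powr a) p = a * f p powr (a - 1) * partial_x f p"
    "partial_y (\<lambda>q. f q powr a) p = a * f p powr (a - 1) * partial_y f p"
    using DERIV_chain2[of "\<lambda>t. t powr a" _ "\<lambda>t. f (t, snd p)" "fst p"]
      DERIV_chain2[of "\<lambda>t. t powr a" _ "\<lambda>t. f (fst p, t)" "snd p"] deriv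
    by (auto intro!: partial_x_eqI partial_y_eqI simp flip: has_real_derivative_iff_has_vector_derivative)
qed

lemma differentiable_powr_const:
  fixes f :: "'a::real_normed_vector \<Rightarrow> real"
  assumes "f differentiable at p" "f p > 0"
  shows "(\<lambda>q. f q powr a) differentiable at p"
proof -
  have "(\<lambda>t. t powr a) differentiable at (f p)"
    using has_real_derivative_powr[OF assms(2)] by (auto simp: real_differentiable_def)
  from differentiable_chain_at[OF assms(1) this] show ?thesis by (simp add: o_def)
qed

subsection \<open>Closure properties of smooth functions\<close>

lemma Ck_on_cong:
  assumes "open U" "\<And>p. p \<in> U \<Longrightarrow> f p = g p" "Ck_on k U f"
  shows "Ck_on k U g"
  using assms(2,3)
proof (induction k arbitrary: f g)
  case 0
  then show ?case using continuous_on_cong[of U U f g] by auto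
next
  case (Suc k)
  have "g differentiable_on U"
    \<comment> \<open>Any positive radius would do, because \<open>f\<close> and \<open>g\<close>
      agree on all of \<open>U\<close>.\<close>
    using Suc.prems by (auto simp: differentiable_on_def intro: differentiable_transform_within[where d = 1])
  moreover have "Ck_on k U (partial_x g)"
    using Suc.IH[of "partial_x f" "partial_x g"] Suc.prems partial_x_cong[OF assms(1), of _ f g] by auto
  moreover have "Ck_on k U (partial_y g)"
    using Suc.IH[of "partial_y f" "partial_y g"] Suc.prems partial_y_cong[OF assms(1), of _ f g] by auto
  ultimately show ?case by simp
qed

lemma Ck_on_SucD: "Ck_on (Suc k) U f \<Longrightarrow> Ck_on k U f"
proof (induction k arbitrary: f)
  case 0
  then show ?case by (simp add: differentiable_imp_continuous_on)
next
  case (Suc k)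
  from Suc.prems have "f differentiable_on U" "Ck_on (Suc k) U (partial_x f)" "Ck_on (Suc k) U (partial_y f)"
    by (simp_all only: Ck_on.simps(2)[of "Suc k"])
  then show ?case
    using Suc.IH[of "partial_x f"] Suc.IH[of "partial_y f"] by (simp only: Ck_on.simps(2)[of k])
qed

text \<open>The induction step of the closure proofs: the partial derivatives are replaced by
  explicit formulas \<open>g\<close> and \<open>h\<close> that need to hold on \<open>U\<close>
  only.\<close>

lemma Ck_on_SucI:
  assumes "open U" "\<And>p. p \<in> U \<Longrightarrow> f differentiable at p"
    and "\<And>p. p \<in> U \<Longrightarrow> partial_x f p = g p" "Ck_on k U g"
    and "\<And>p. p \<in> U \<Longrightarrow> partial_y f p = h p" "Ck_on k U h"
  shows "Ck_on (Suc k) U f"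
  using assms Ck_on_cong[of U g "partial_x f" k] Ck_on_cong[of U h "partial_y f" k]
  by (simp add: differentiable_on_eq_differentiable_at)

lemma Ck_on_Suc_differentiable: "open U \<Longrightarrow> Ck_on (Suc k) U f \<Longrightarrow> p \<in> U \<Longrightarrow> f differentiable at p"
  by (simp add: differentiable_on_eq_differentiable_at)

lemma Ck_on_add:
  assumes "open U" "Ck_on k U f" "Ck_on k U g"
  shows "Ck_on k U (\<lambda>p. f p + g p)"
  using assms(2,3)
proof (induction k arbitrary: f g)
  case 0
  then show ?case by (simp add: continuous_on_add)
next
  case (Suc k)
  then show ?case
    using Suc.prems[THEN Ck_on_Suc_differentiable[OF assms(1)]] assms(1)
    by (intro Ck_on_SucI[OF assms(1) _ partial_x_add _ partial_y_add] differentiable_add) auto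
qed

lemma Ck_on_scaleR_const:
  fixes f :: "real \<times> real \<Rightarrow> real"
  assumes "open U" "Ck_on k U f"
  shows "Ck_on k U (\<lambda>p. f p *\<^sub>R c)"
  using assms(2)
proof (induction k arbitrary: f)
  case 0
  then show ?case by (auto intro: continuous_intros)
next
  case (Suc k)
  then show ?case
    using Ck_on_Suc_differentiable[OF assms(1) Suc.prems] assms(1)
    by (intro Ck_on_SucI[OF assms(1) _ partial_x_scaleR_const _ partial_y_scaleR_const]
        differentiable_scaleR) auto
qed

lemma Ck_on_mult:
  fixes f g :: "real \<times> real \<Rightarrow> real"
  assumes "open U" "Ck_on k U f" "Ck_on k U g"
  shows "Ck_on k U (\<lambda>p. f p * g p)"
  using assms(2,3)
proof (induction k arbitrary: f g)
  case 0
  then show ?case by (auto intro: continuous_intros)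
next
  case (Suc k)
  then show ?case
    \<comment> \<open>The Leibniz rule also contains the undifferentiated factors, so
      \<open>f\<close> and \<open>g\<close> are needed at order \<open>k\<close> as well.\<close>
    using Suc.prems[THEN Ck_on_Suc_differentiable[OF assms(1)]] assms(1) Ck_on_SucD[of k U f] Ck_on_SucD[of k U g]
    by (intro Ck_on_SucI[OF assms(1) _ partial_x_mult _ partial_y_mult] differentiable_mult Ck_on_add) auto
qed

text \<open>Differentiation lowers the exponent to \<open>a - 1\<close>, so the induction on
  \<open>k\<close> must range over all exponents while \<open>f\<close> stays fixed.\<close>

lemma Ck_on_powr:
  fixes f :: "real \<times> real \<Rightarrow> real"
  assumes "open U" "Ck_on k U f" "\<And>p. p \<in> U \<Longrightarrow> f p > 0"
  shows "Ck_on k U (\<lambda>p. f p powr a)"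
  using assms(2)
proof (induction k arbitrary: a)
  case 0
  then show ?case using assms(3) by (force intro!: continuous_intros)
next
  case (Suc k)
  have "Ck_on k U (\<lambda>p. a * f p powr (a - 1))"
    using Ck_on_scaleR_const[OF assms(1) Suc.IH[of "a - 1"], of a] Suc.prems Ck_on_SucD[of k U f]
    by (simp add: mult.commute)
  then have "Ck_on k U (\<lambda>p. a * f p powr (a - 1) * partial_x f p)"
    "Ck_on k U (\<lambda>p. a * f p powr (a - 1) * partial_y f p)"
    using Suc.prems by (auto intro!: Ck_on_mult[OF assms(1)])
  then show ?case
    using Ck_on_Suc_differentiable[OF assms(1) Suc.prems] assms(3)
    by (intro Ck_on_SucI[OF assms(1) _ partial_x_powr _ partial_y_powr] differentiable_powr_const) auto
qed

lemma smooth_on_cong: "open U \<Longrightarrow> (\<And>p. p \<in> U \<Longrightarrow> f p = g p) \<Longrightarrow> smooth_on U f \<Longrightarrow> smooth_on U g"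
  unfolding smooth_on_def by (metis Ck_on_cong)

lemma smooth_on_add:
  "open U \<Longrightarrow> smooth_on U f \<Longrightarrow> smooth_on U g \<Longrightarrow> smooth_on U (\<lambda>p. f p + g p)"
  by (simp add: smooth_on_def Ck_on_add)

lemma smooth_on_scaleR_const:
  fixes f :: "real \<times> real \<Rightarrow> real"
  shows "open U \<Longrightarrow> smooth_on U f \<Longrightarrow> smooth_on U (\<lambda>p. f p *\<^sub>R c)"
  by (simp add: smooth_on_def Ck_on_scaleR_const)

lemma smooth_on_mult:
  fixes f g :: "real \<times> real \<Rightarrow> real"
  shows "open U \<Longrightarrow> smooth_on U f \<Longrightarrow> smooth_on U g \<Longrightarrow> smooth_on U (\<lambda>p. f p * g p)"
  by (simp add: smooth_on_def Ck_on_mult)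

lemma smooth_on_powr:
  fixes f :: "real \<times> real \<Rightarrow> real"
  shows "open U \<Longrightarrow> smooth_on U f \<Longrightarrow> (\<And>p. p \<in> U \<Longrightarrow> f p > 0) \<Longrightarrow> smooth_on U (\<lambda>p. f p powr a)"
  by (simp add: smooth_on_def Ck_on_powr)

lemma smooth_on_partial_x: "smooth_on U f \<Longrightarrow> smooth_on U (partial_x f)"
  unfolding smooth_on_def by (metis Ck_on.simps(2))

lemma smooth_on_partial_y: "smooth_on U f \<Longrightarrow> smooth_on U (partial_y f)"
  unfolding smooth_on_def by (metis Ck_on.simps(2))

lemma smooth_on_differentiable: "open U \<Longrightarrow> smooth_on U f \<Longrightarrow> p \<in> U \<Longrightarrow> f differentiable at p"
  unfolding smooth_on_def by (metis Ck_on_Suc_differentiable)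

lemma smooth_on_continuous: "smooth_on U f \<Longrightarrow> continuous_on U f"
  unfolding smooth_on_def by (metis Ck_on.simps(1))

subsection \<open>Symmetry of mixed partial derivatives\<close>

lemma second_difference_mvt:
  fixes f :: "real \<Rightarrow> real \<Rightarrow> real"
  assumes "h > 0"
    and f': "\<And>s t. s \<in> {a..a+h} \<Longrightarrow> t \<in> {b..b+h} \<Longrightarrow> ((\<lambda>s. f s t) has_real_derivative f' s t) (at s)"
    and f'': "\<And>s t. s \<in> {a..a+h} \<Longrightarrow> t \<in> {b..b+h} \<Longrightarrow> ((\<lambda>t. f' s t) has_real_derivative f'' s t) (at t)"
  obtains s t where "s \<in> {a..a+h}" "t \<in> {b..b+h}"
    "f (a+h) (b+h) - f (a+h) b - f a (b+h) + f a b = h\<^sup>2 * f'' s t"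
proof -
  \<comment> \<open>The second difference is the increment of \<open>f s (b+h) - f s b\<close> as
    \<open>s\<close> runs from \<open>a\<close> to \<open>a+h\<close>. A first mean value step acts
    in \<open>s\<close>, a second one on \<open>f' s\<close> in \<open>t\<close>.\<close>
  have "\<exists>s>a. s < a+h \<and> (f (a+h) (b+h) - f (a+h) b) - (f a (b+h) - f a b)
      = (a+h-a) * (f' s (b+h) - f' s b)"
    using assms(1) by (intro MVT2 DERIV_diff f') auto
  then obtain s where s: "s \<in> {a..a+h}"
    "f (a+h) (b+h) - f (a+h) b - f a (b+h) + f a b = h * (f' s (b+h) - f' s b)"
    by (metis add_diff_cancel_left' atLeastAtMost_iff diff_diff_eq2 less_imp_le diff_add_eq)
  have "\<exists>t>b. t < b+h \<and> f' s (b+h) - f' s b = (b+h-b) * f'' s t"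
    using assms(1) s by (intro MVT2 f'') auto
  then obtain t where "t \<in> {b..b+h}" "f' s (b+h) - f' s b = h * f'' s t"
    by (metis add_diff_cancel_left' atLeastAtMost_iff less_imp_le)
  with s that show ?thesis by (simp add: power2_eq_square)
qed

text \<open>If the two continuous mixed derivatives differed at \<open>p\<close>, their values would
  stay apart on a small square at \<open>p\<close>. The second difference over that square does not
  depend on the order of the variables, and the mean value lemma expresses it through either
  derivative.\<close>

lemma mixed_partials_commute:
  fixes f :: "real \<times> real \<Rightarrow> real"
  assumes "open U" "smooth_on U f" "p \<in> U"
  shows "partial_x (partial_y f) p = partial_y (partial_x f) p"
proof (rule ccontr)
  let ?F = "partial_x (partial_y f)" and ?G = "partial_y (partial_x f)"
  assume neq: "?F p \<noteq> ?G p"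
  \<comment> \<open>Half the gap: the \<open>e\<close>-balls around the two values at
    \<open>p\<close> are disjoint.\<close>
  define e where "e = \<bar>?F p - ?G p\<bar> / 2"
  have e: "e > 0" using neq by (simp add: e_def)
  have "isCont ?F p" "isCont ?G p"
    using assms smooth_on_partial_x smooth_on_partial_y smooth_on_continuous
    by (metis continuous_on_eq_continuous_at)+
  then have "\<forall>\<^sub>F q in nhds p. dist (?F q) (?F p) < e" "\<forall>\<^sub>F q in nhds p. dist (?G q) (?G p) < e"
    using e by (auto simp: isCont_def tendsto_at_iff_tendsto_nhds dest: tendstoD)
  moreover have "\<forall>\<^sub>F q in nhds p. q \<in> U"
    using assms by (simp add: eventually_nhds_in_open)
  ultimately have "\<forall>\<^sub>F q in nhds p. q \<in> U \<and> dist (?F q) (?F p) < e \<and> dist (?G q) (?G p) < e"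
    by eventually_elim auto
  then obtain d where d: "d > 0"
    "\<And>q. dist q p < d \<Longrightarrow> q \<in> U \<and> dist (?F q) (?F p) < e \<and> dist (?G q) (?G p) < e"
    by (auto simp: eventually_nhds_metric)
  obtain a b where p: "p = (a, b)" by (cases p)
  \<comment> \<open>On the square of side \<open>h\<close> the distance to its corner
    \<open>p\<close> is at most \<open>2 * h\<close>, which is below \<open>d\<close>.\<close>
  define h where "h = d / 3"
  have h: "h > 0" using d by (simp add: h_def)
  have near: "dist (s, t) p < d" if "s \<in> {a..a+h}" "t \<in> {b..b+h}" for s t
  proof -
    have "dist (s, t) p \<le> \<bar>s - a\<bar> + \<bar>t - b\<bar>"
      by (simp add: p dist_Pair_Pair dist_real_def sqrt_sum_squares_le_sum_abs)
    also have "\<dots> < d" using that h by (simp add: h_def)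
    finally show ?thesis .
  qed
  have D: "((\<lambda>s. g (s, t)) has_real_derivative partial_x g (s, t)) (at s)"
    "((\<lambda>t. g (s, t)) has_real_derivative partial_y g (s, t)) (at t)"
    if "smooth_on U g" "s \<in> {a..a+h}" "t \<in> {b..b+h}" for g s t
    using has_vector_derivative_partial_x[of g "(s, t)"] has_vector_derivative_partial_y[of g "(s, t)"]
      smooth_on_differentiable[OF assms(1) that(1), of "(s, t)"] d(2)[OF near[OF that(2,3)]]
    by (auto simp: has_real_derivative_iff_has_vector_derivative)
  note fx = smooth_on_partial_x[OF assms(2)] and fy = smooth_on_partial_y[OF assms(2)]
  obtain s t where 1: "s \<in> {a..a+h}" "t \<in> {b..b+h}"
    "f (a+h, b+h) - f (a+h, b) - f (a, b+h) + f (a, b) = h\<^sup>2 * ?G (s, t)"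
    by (rule second_difference_mvt[OF h, of a b "\<lambda>s t. f (s, t)" "\<lambda>s t. partial_x f (s, t)" "\<lambda>s t. ?G (s, t)"])
      (auto intro: D assms(2) fx)
  \<comment> \<open>The same square with the roles of the variables exchanged; only the order of the
    two middle terms changes.\<close>
  obtain t' s' where 2: "t' \<in> {b..b+h}" "s' \<in> {a..a+h}"
    "f (a+h, b+h) - f (a, b+h) - f (a+h, b) + f (a, b) = h\<^sup>2 * ?F (s', t')"
    by (rule second_difference_mvt[OF h, of b a "\<lambda>t s. f (s, t)" "\<lambda>t s. partial_y f (s, t)" "\<lambda>t s. ?F (s, t)"])
      (auto intro: D assms(2) fy)
  have "h\<^sup>2 * ?G (s, t) = h\<^sup>2 * ?F (s', t')" using 1 2 by linarith
  then have "?G (s, t) = ?F (s', t')" using h by simp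
  moreover have "dist (?G (s, t)) (?G p) < e" "dist (?F (s', t')) (?F p) < e"
    using d(2) near 1 2 by blast+
  ultimately show False by (simp add: e_def dist_real_def abs_if split: if_splits)
qed

subsection \<open>The zero curvature representation\<close>

text \<open>\<open>M_diag\<close> and \<open>M_off\<close> split sl(2) into its Cartan subalgebra
  and the off-diagonal complement. Used with constant arguments, they absorb the complex parameters
  \<open>l\<close> and \<open>s\<close>.\<close>

definition M_diag :: "complex \<Rightarrow> complex^2^2" where
  "M_diag c = vector [vector [c, 0], vector [0, - c]]"

definition M_off :: "complex \<Rightarrow> complex \<Rightarrow> complex^2^2" where
  "M_off b c = vector [vector [0, b], vector [c, 0]]"

lemma A_mat_eq:
  assumes "z p > 0"
  shows "A_mat l s z p = partial_y z p *\<^sub>R M_diag (s / 2)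
    + (partial_x z p * z p powr - 1) *\<^sub>R M_diag ((1 + 2 * l) / 4)
    + z p powr (1/2) *\<^sub>R M_off (l + 1) l"
proof -
  have "z p powr - 1 = 1 / z p" "z p powr (1/2) = sqrt (z p)"
    using assms by (simp_all add: powr_minus_divide powr_half_sqrt)
  then show ?thesis
    by (simp add: A_mat_def M_diag_def M_off_def Let_def vec_eq_iff forall_2
        scaleR_conv_of_real[where 'a = complex] algebra_simps)
qed

lemma B_mat_eq:
  assumes "z p > 0"
  shows "B_mat l s z p = (partial_x z p * z p powr - 2) *\<^sub>R M_diag (s / 2)
    + (partial_y z p * z p powr - 1) *\<^sub>R M_diag ((1 + 2 * l) / 4)
    + z p powr (- (1/2)) *\<^sub>R M_off s s"
proof -
  have "z p powr - 1 = 1 / z p" "z p powr - 2 = 1 / (z p)\<^sup>2" "z p powr (- (1/2)) = 1 / sqrt (z p)"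
    using assms by (simp_all add: powr_minus_divide powr_half_sqrt)
  then show ?thesis
    by (simp add: B_mat_def M_diag_def M_off_def Let_def vec_eq_iff forall_2
        scaleR_conv_of_real[where 'a = complex] algebra_simps)
qed

text \<open>Diagonal matrices commute, a diagonal with an off-diagonal one brackets to an
  off-diagonal one, and two off-diagonal ones bracket to a diagonal one.\<close>

lemma commutator_M_diag_M_off:
  "commutator (M_diag a + M_off b c) (M_diag a' + M_off b' c')
    = M_diag (b * c' - b' * c) + M_off (2 * (a * b' - a' * b)) (2 * (a' * c - a * c'))"
  by (simp add: commutator_def M_diag_def M_off_def vec_eq_iff forall_2 matrix_matrix_mult_def sum_2
      algebra_simps)

text \<open>The right-hand side uses the same constant matrices as \<open>A_mat_eq\<close> and
  \<open>B_mat_eq\<close>, so that the curvature can be cancelled coefficient by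
  coefficient.\<close>

lemma commutator_A_mat_B_mat:
  fixes l s :: complex
  assumes "s\<^sup>2 = l\<^sup>2 + l" "z p > 0"
  shows "commutator (A_mat l s z p) (B_mat l s z p) = 2 *\<^sub>R M_diag (s / 2)
    - (partial_y z p * z p powr - (1/2) / 2) *\<^sub>R M_off (l + 1) l
    - (partial_x z p * z p powr - (3/2) / 2) *\<^sub>R M_off s s"
proof -
  \<comment> \<open>In terms of \<open>r\<close> all half-integer powers of \<open>z p\<close>
    become integer powers, and the claim becomes a rational identity.\<close>
  define r where "r = sqrt (z p)"
  have r: "r > 0" "z p = r\<^sup>2" using assms by (auto simp: r_def)
  have pw: "(r\<^sup>2) powr - (1/2) = 1 / r" "(r\<^sup>2) powr - (3/2) = 1 / r^3"
    using r(1) by (simp_all add: powr_minus_divide powr_powr flip: powr_numeral)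
  define R X Y where "R = complex_of_real r" and "X = complex_of_real (partial_x z p)"
    and "Y = complex_of_real (partial_y z p)"
  have R: "R \<noteq> 0" using r by (simp add: R_def)
  define a b where "a = s / 2 * Y + (1 + 2 * l) / 4 * (X / R\<^sup>2)"
    and "b = s / 2 * (X / R^4) + (1 + 2 * l) / 4 * (Y / R\<^sup>2)"
  have A: "A_mat l s z p = M_diag a + M_off ((l + 1) * R) (l * R)"
    using r(1) by (simp add: A_mat_def M_diag_def M_off_def Let_def vec_eq_iff forall_2 r(2)
        R_def X_def Y_def a_def)
  have B: "B_mat l s z p = M_diag b + M_off (s / R) (s / R)"
    using r(1) by (simp add: B_mat_def M_diag_def M_off_def Let_def vec_eq_iff forall_2 r(2)
        R_def X_def Y_def b_def)
  \<comment> \<open>The diagonal entry: all dependence on \<open>z\<close> cancels, which produces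
    the constant that balances the 2 of the equation.\<close>
  have "(l + 1) * R * (s / R) - s / R * (l * R) = s"
    using R by (simp add: field_simps)
  \<comment> \<open>The upper off-diagonal entry, sorted by \<open>Y / R\<close> and
    \<open>X / R^3\<close>. The relation for \<open>s\<^sup>2\<close> is needed only in the
    coefficient of \<open>Y / R\<close>, which becomes \<open>- (l + 1) / 2\<close>. The lower entry
    is treated alike and gives \<open>- l / 2\<close> there.\<close>
  moreover have "2 * (a * (s / R) - b * ((l + 1) * R))
      = (s\<^sup>2 - (1 + 2 * l) * (l + 1) / 2) * (Y / R) + (s * (1 + 2 * l) / 2 - s * (l + 1)) * (X / R^3)"
    using R by (simp add: a_def b_def field_simps power2_eq_square power3_eq_cube power4_eq_xxxx)
  then have "2 * (a * (s / R) - b * ((l + 1) * R)) = - (Y / R / 2) * (l + 1) - X / R^3 / 2 * s"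
    unfolding assms(1) by (simp add: algebra_simps power2_eq_square add_divide_distrib diff_divide_distrib)
  moreover have "2 * (b * (l * R) - a * (s / R))
      = ((1 + 2 * l) * l / 2 - s\<^sup>2) * (Y / R) + (s * l - s * (1 + 2 * l) / 2) * (X / R^3)"
    using R by (simp add: a_def b_def field_simps power2_eq_square power3_eq_cube power4_eq_xxxx)
  then have "2 * (b * (l * R) - a * (s / R)) = - (Y / R / 2) * l - X / R^3 / 2 * s"
    unfolding assms(1) by (simp add: algebra_simps power2_eq_square add_divide_distrib diff_divide_distrib)
  ultimately show ?thesis
    unfolding A B commutator_M_diag_M_off r(2) pw
    by (simp add: M_diag_def M_off_def vec_eq_iff forall_2 scaleR_conv_of_real[where 'a = complex]
        flip: R_def X_def Y_def)
qed

section \<open>Smooth dependence on the first-order jet, and tracelessness\<close>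

lemma differential_function_A_mat: "differential_function (A_mat l s)"
  unfolding differential_function_def
\<comment> \<open>Jet order 1 suffices, since only \<open>z\<close> and its first derivatives enter;
  the index pairs used at the end pick out exactly these three.\<close>
proof (intro conjI allI impI exI[of _ 1])
  fix U z assume z: "positive_smooth U z"
  then have "smooth_on U z" "open U" "\<And>p. p \<in> U \<Longrightarrow> z p > 0" by (auto simp: positive_smooth_def)
  then show "smooth_on U (A_mat l s z)"
    by (intro smooth_on_cong[OF _ A_mat_eq[symmetric]] smooth_on_add smooth_on_scaleR_const
        smooth_on_mult smooth_on_powr smooth_on_partial_x smooth_on_partial_y)
next
  fix U z p V w q
  assume "positive_smooth U z \<and> p \<in> U \<and> positive_smooth V w \<and> q \<in> V \<and> jet_agree 1 z p w q"
  then have *: "i + j \<le> 1 \<Longrightarrow> (partial_x ^^ i) ((partial_y ^^ j) z) p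
      = (partial_x ^^ i) ((partial_y ^^ j) w) q" for i j
    by (auto simp: jet_agree_def)
  show "A_mat l s z p = A_mat l s w q"
    using *[of 0 0] *[of 1 0] *[of 0 1] by (simp add: A_mat_def)
qed

lemma differential_function_B_mat: "differential_function (B_mat l s)"
  unfolding differential_function_def
proof (intro conjI allI impI exI[of _ 1])
  fix U z assume z: "positive_smooth U z"
  then have "smooth_on U z" "open U" "\<And>p. p \<in> U \<Longrightarrow> z p > 0" by (auto simp: positive_smooth_def)
  then show "smooth_on U (B_mat l s z)"
    by (intro smooth_on_cong[OF _ B_mat_eq[symmetric]] smooth_on_add smooth_on_scaleR_const
        smooth_on_mult smooth_on_powr smooth_on_partial_x smooth_on_partial_y)
next
  fix U z p V w q
  assume "positive_smooth U z \<and> p \<in> U \<and> positive_smooth V w \<and> q \<in> V \<and> jet_agree 1 z p w q"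
  then have *: "i + j \<le> 1 \<Longrightarrow> (partial_x ^^ i) ((partial_y ^^ j) z) p
      = (partial_x ^^ i) ((partial_y ^^ j) w) q" for i j
    by (auto simp: jet_agree_def)
  show "B_mat l s z p = B_mat l s w q"
    using *[of 0 0] *[of 1 0] *[of 0 1] by (simp add: B_mat_def)
qed

lemma A_mat_B_mat_in_sl2: "A_mat l s z p \<in> sl2" "B_mat l s z p \<in> sl2"
  by (simp_all add: sl2_def A_mat_def B_mat_def Let_def trace_def sum_2)

section \<open>Vanishing of the curvature on solutions\<close>

lemma A_mat_B_mat_zero_curvature:
  fixes l s :: complex
  assumes "s\<^sup>2 = l\<^sup>2 + l" "constant_astigmatism_solution U z" "p \<in> U"
  shows "partial_y (A_mat l s z) p - partial_x (B_mat l s z) p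
    + commutator (A_mat l s z p) (B_mat l s z p) = 0"
proof -
  have U: "open U" and z: "smooth_on U z" and pos: "\<And>q. q \<in> U \<Longrightarrow> z q > 0"
    and sol: "partial_y (partial_y z) p + partial_x (partial_x (\<lambda>q. 1 / z q)) p + 2 = 0"
    using assms(2,3) by (auto simp: constant_astigmatism_solution_def positive_smooth_def)
  note sm = smooth_on_add smooth_on_scaleR_const smooth_on_mult smooth_on_powr
    smooth_on_partial_x smooth_on_partial_y
  note diff = smooth_on_differentiable[OF U _ assms(3)]
  note zd = diff[OF z]
  \<comment> \<open>Up to sign, the first derivative of \<open>1 / z\<close> is the coefficient of
    \<open>M_diag (s / 2)\<close> in \<open>B_mat_eq\<close>. It is needed on all of
    \<open>U\<close>, because it is differentiated once more.\<close>
  have "partial_x (\<lambda>q. 1 / z q) q = (partial_x z q * z q powr - 2) * - 1" if "q \<in> U" for q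
  proof -
    have "partial_x (\<lambda>q. 1 / z q) q = partial_x (\<lambda>q. z q powr - 1) q"
      using pos by (intro partial_x_cong[OF U that]) (simp add: powr_minus_divide less_imp_le)
    then show ?thesis
      using partial_x_powr[OF smooth_on_differentiable[OF U z that] pos[OF that], of "- 1"] by simp
  qed
  from partial_x_cong[OF U assms(3) this]
  have "partial_x (partial_x (\<lambda>q. 1 / z q)) p = partial_x (\<lambda>q. (partial_x z q * z q powr - 2) *\<^sub>R - 1) p"
    by simp
  also have "\<dots> = - partial_x (\<lambda>q. partial_x z q * z q powr - 2) p"
    by (subst partial_x_scaleR_const) (auto intro!: diff sm U z pos)
  \<comment> \<open>The equation solved for the derivative that occurs in the diagonal part of
    \<open>partial_x (B_mat l s z) p\<close>.\<close>
  finally have eq: "partial_x (\<lambda>q. partial_x z q * z q powr - 2) p = partial_y (partial_y z) p + 2"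
    using sol by simp
  have "partial_y (A_mat l s z) p = partial_y (\<lambda>q. partial_y z q *\<^sub>R M_diag (s / 2)
    + (partial_x z q * z q powr - 1) *\<^sub>R M_diag ((1 + 2 * l) / 4)
    + z q powr (1/2) *\<^sub>R M_off (l + 1) l) p"
    by (intro partial_y_cong[OF U assms(3)] A_mat_eq pos)
  also have "\<dots> = partial_y (partial_y z) p *\<^sub>R M_diag (s / 2)
    + partial_y (\<lambda>q. partial_x z q * z q powr - 1) p *\<^sub>R M_diag ((1 + 2 * l) / 4)
    + partial_y (\<lambda>q. z q powr (1/2)) p *\<^sub>R M_off (l + 1) l"
    by (intro partial_y_sum3 diff sm U z pos)
  finally have Ay: "partial_y (A_mat l s z) p = \<dots>" .
  have "partial_x (B_mat l s z) p = partial_x (\<lambda>q. (partial_x z q * z q powr - 2) *\<^sub>R M_diag (s / 2)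
    + (partial_y z q * z q powr - 1) *\<^sub>R M_diag ((1 + 2 * l) / 4)
    + z q powr (- (1/2)) *\<^sub>R M_off s s) p"
    by (intro partial_x_cong[OF U assms(3)] B_mat_eq pos)
  also have "\<dots> = partial_x (\<lambda>q. partial_x z q * z q powr - 2) p *\<^sub>R M_diag (s / 2)
    + partial_x (\<lambda>q. partial_y z q * z q powr - 1) p *\<^sub>R M_diag ((1 + 2 * l) / 4)
    + partial_x (\<lambda>q. z q powr (- (1/2))) p *\<^sub>R M_off s s"
    by (intro partial_x_sum3 diff sm U z pos)
  finally have Bx: "partial_x (B_mat l s z) p = \<dots>" .
  note powr_d = differentiable_powr_const[OF zd pos[OF assms(3)]]
  \<comment> \<open>Both sides are expanded by the product rule. The terms with the product of the
    two first derivatives agree, and the others differ only in the order of differentiation.\<close>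
  have mixed: "partial_y (\<lambda>q. partial_x z q * z q powr - 1) p
      = partial_x (\<lambda>q. partial_y z q * z q powr - 1) p"
    unfolding partial_y_mult[OF diff[OF smooth_on_partial_x[OF z]] powr_d]
      partial_x_mult[OF diff[OF smooth_on_partial_y[OF z]] powr_d]
      partial_x_powr[OF zd pos[OF assms(3)]] partial_y_powr[OF zd pos[OF assms(3)]]
      mixed_partials_commute[OF U z assms(3)]
    by simp
  \<comment> \<open>These are the off-diagonal coefficients of the commutator, up to the signs that
    make them cancel.\<close>
  have "partial_y (\<lambda>q. z q powr (1/2)) p = partial_y z p * z p powr - (1/2) / 2"
    "partial_x (\<lambda>q. z q powr (- (1/2))) p = - (partial_x z p * z p powr - (3/2) / 2)"
    using partial_y_powr[OF zd pos[OF assms(3)], of "1/2"] partial_x_powr[OF zd pos[OF assms(3)], of "- (1/2)"]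
    by simp_all
  then show ?thesis
    unfolding Ay Bx mixed eq commutator_A_mat_B_mat[of s l z p, OF assms(1) pos[OF assms(3)]]
    by (simp add: algebra_simps)
qed

theorem mainTheorem1:
  fixes l s :: complex
  assumes "s\<^sup>2 = l\<^sup>2 + l"
  shows "zero_curvature_representation (A_mat l s) (B_mat l s)"
  using assms unfolding zero_curvature_representation_def
  by (simp add: differential_function_A_mat differential_function_B_mat A_mat_B_mat_in_sl2
      A_mat_B_mat_zero_curvature)

end
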